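(* In the codimension-one setting described in the context, let $\beta\in V_{\mathbb{C}}$ be nonresonant. Then for every $v\in E'_\beta$ and every $u\in\mathbb{Z}A$: $v$ has minimal $(I,u)$-negative support for all $I\subseteq\{1,\dots,n\}$ with $|I|\ge n-(m_v-1)$, and the series $\Phi^\emptyset_{v,\beta+u}(x)$ is nonzero.
   Context: Setting: $A=\{\mathbf{a}_1,\dots,\mathbf{a}_n\}\subseteq\mathbb{Z}^d$, $V\subseteq\mathbb{R}^d$ is the real span of $A$, $V_{\mathbb{C}}\subseteq\mathbb{C}^d$ its complex span, $\mathbb{Z}A$ the abelian group generated by $A$. It is assumed that $\dim V=n-1$ and that each subset of $A$ of cardinality $n-1$ is linearly independent. The lattice of integer relations on $A$ is generated by a single relation $\sum_{i=1}^k \ell_i\mathbf{a}_i-\sum_{j=k+1}^n\ell_j\mathbf{a}_j=\mathbf{0}$, where $1\le k\le n$ and $\ell_1,\dots,\ell_n$ are relatively prime positive integers. Put $\ell=(\ell_1,\dots,\ell_k,-\ell_{k+1},\dots,-\ell_n)$, $x_0=\prod_{i=1}^kx_i^{\ell_i}/\prod_{j=k+1}^nx_j^{\ell_j}$, and $x^w=\prod_\mu x_\mu^{w_\mu}$ for $w\in\mathbb{C}^n$. Nonresonance: for $1\le i\le k<j\le n$, $H_{ij}\subseteq V$ is the hyperplane through the origin containing $A\setminus\{\mathbf{a}_i,\mathbf{a}_j\}$, and $h_{ij}$ is the linear function on $V$ (unique up to sign) vanishing on $H_{ij}$ with $h_{ij}(\mathbb{Z}A)=\mathbb{Z}$, extended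 $\mathbb{C}$-linearly to $V_{\mathbb{C}}$. $\beta$ is nonresonant if $h_{ij}(\beta)\notin\mathbb{Z}$ for all $1\le i\le k$ and $k+1\le j\le n$ (equivalently, $\beta+\mathbb{Z}A$ contains no point on the complexified hyperplanes spanned by facets, containing the origin, of the convex hull of $A\cup\{\mathbf{0}\}$). Exponents: for $i\in\{1,\dots,k\}$, $b\in\{0,\dots,\ell_i-1\}$, $v^{(i,b)}\in\mathbb{C}^n$ is the unique vector with $v^{(i,b)}_i=b$ and $\sum_\mu v^{(i,b)}_\mu\mathbf{a}_\mu=\beta$. $E_\beta$ is the set of all $v^{(i,b)}$; $E'_\beta=\{v\in E_\beta\mid v_i\notin\mathbb{Z}_{<0}\text{ for }i=1,\dots,k\}$; for $v\in E'_\beta$, $m_v=|\{i\in\{1,\dots,k\}\mid v_i\in\mathbb{Z}_{\ge0}\}|$. Negative supports: $L(u)=\{l\in\mathbb{Z}^n\mid\sum_jl_j\mathbf{a}_j=u\}$; for $I\subseteq\{1,\dots,n\}$, $I\text{-nsupp}(w)=\{i\in I\mid w_i\in\mathbb{Z}_{<0}\}$; $v$ has minimal $(I,u)$-negative support if $I\text{-nsupp}(v+l)$ is not a proper subset of $I\text{-nsupp}(v)$ for any $l\in L(u)$. For $c\in\mathbb{C}$: $M_{0,0}(c)=1$; $M_{l,0}(c)=\frac1{(c+1)(c+2)\cdots(c+l)}$ for $l>0$ (with $c+l<0$ if $c\in\mathbb{Z}_{<0}$); $M_{l,0}(c)=c(c-1)\cdots(c+l+1)$ for $l<0$. Choose $\ell^{(u)}\in\mathbb{Z}^n$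 with $\sum_\sigma\ell^{(u)}_\sigma\mathbf{a}_\sigma=u$. Then $$\Phi^\emptyset_{v,\beta+u}(x)=x^{v+\ell^{(u)}}\sum_{z}\Big(\prod_{i=1}^kM_{\ell^{(u)}_i+z\ell_i,0}(v_i)\prod_{j=k+1}^nM_{\ell^{(u)}_j-z\ell_j,0}(v_j)\Big)x_0^z,$$ the sum being over all $z\in\mathbb{Z}$ with $\{1,\dots,n\}\text{-nsupp}(v+\ell^{(u)}+z\ell)=\{1,\dots,n\}\text{-nsupp}(v)$. (It is independent of the choice of $\ell^{(u)}$.) *)

theory Defs
  imports "HOL-Analysis.Analysis"
begin

text \<open>
  The points are a family \<open>a 1, \<dots>, a n\<close> of integer vectors.  Vectors with coordinates
  \<open>1, \<dots>, n\<close> are functions on \<open>nat\<close> that vanish outside \<open>{1..n}\<close>, so that equality of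
  functions is equality of vectors.
\<close>

definition coord_space :: "nat \<Rightarrow> (nat \<Rightarrow> 'a::zero) set" where
  "coord_space n = {w. \<forall>\<mu>. \<mu> \<notin> {1..n} \<longrightarrow> w \<mu> = 0}"

definition of_int_vec :: "int ^ 'd \<Rightarrow> 'a::ring_1 ^ 'd" where
  "of_int_vec x = (\<chi> t. of_int (x $ t))"

definition real_pts :: "(nat \<Rightarrow> int ^ 'd) \<Rightarrow> nat \<Rightarrow> (real ^ 'd) set" where
  "real_pts a n = (\<lambda>\<mu>. of_int_vec (a \<mu>)) ` {1..n}"

definition real_V :: "(nat \<Rightarrow> int ^ 'd) \<Rightarrow> nat \<Rightarrow> (real ^ 'd) set" where
  "real_V a n = span (real_pts a n)"

definition complex_V :: "(nat \<Rightarrow> int ^ 'd) \<Rightarrow> nat \<Rightarrow> (complex ^ 'd) set" where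
  "complex_V a n = vec.span ((\<lambda>\<mu>. of_int_vec (a \<mu>)) ` {1..n})"

definition ZA :: "(nat \<Rightarrow> int ^ 'd) \<Rightarrow> nat \<Rightarrow> (int ^ 'd) set" where
  "ZA a n = {\<Sum>\<mu>=1..n. l \<mu> *s a \<mu> | l. True}"

definition int_sols :: "(nat \<Rightarrow> int ^ 'd) \<Rightarrow> nat \<Rightarrow> int ^ 'd \<Rightarrow> (nat \<Rightarrow> int) set" where
  "int_sols a n u = {l \<in> coord_space n. (\<Sum>\<mu>=1..n. l \<mu> *s a \<mu>) = u}"

definition signed_rel :: "nat \<Rightarrow> nat \<Rightarrow> (nat \<Rightarrow> nat) \<Rightarrow> nat \<Rightarrow> int" where
  "signed_rel n k ell \<mu> =
     (if \<mu> \<in> {1..k} then int (ell \<mu>) else if \<mu> \<in> {k+1..n} then - int (ell \<mu>) else 0)"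

definition H_hyperplane ::
  "(nat \<Rightarrow> int ^ 'd) \<Rightarrow> nat \<Rightarrow> nat \<Rightarrow> nat \<Rightarrow> (real ^ 'd) set \<Rightarrow> bool" where
  "H_hyperplane a n i j H \<longleftrightarrow>
     subspace H \<and> H \<subseteq> real_V a n \<and> dim H + 1 = dim (real_V a n) \<and>
     real_pts a n - {of_int_vec (a i), of_int_vec (a j)} \<subseteq> H"

text \<open>
  A linear function on \<open>V\<close> is represented by any linear extension to the ambient space; only its
  values on \<open>V\<close> are constrained, and only these are used.
\<close>

definition h_functional ::
  "(nat \<Rightarrow> int ^ 'd) \<Rightarrow> nat \<Rightarrow> (real ^ 'd) set \<Rightarrow> (real ^ 'd \<Rightarrow> real) \<Rightarrow> bool" where
  "h_functional a n H h \<longleftrightarrow>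
     linear h \<and> (\<forall>x\<in>H. h x = 0) \<and> h ` of_int_vec ` ZA a n = \<int>"

definition complexify :: "(real ^ 'd \<Rightarrow> real) \<Rightarrow> complex ^ 'd \<Rightarrow> complex" where
  "complexify h \<beta> = Complex (h (\<chi> t. Re (\<beta> $ t))) (h (\<chi> t. Im (\<beta> $ t)))"

text \<open>
  In the codimension-one setting \<open>H\<close> is determined by \<open>i, j\<close>, and \<open>h\<close> is determined on \<open>V\<close> up
  to sign, which does not affect integrality; hence the quantification over all of them.
\<close>

definition nonresonant ::
  "(nat \<Rightarrow> int ^ 'd) \<Rightarrow> nat \<Rightarrow> nat \<Rightarrow> complex ^ 'd \<Rightarrow> bool" where
  "nonresonant a n k \<beta> \<longleftrightarrow>
     (\<forall>i\<in>{1..k}. \<forall>j\<in>{k+1..n}. \<forall>H h.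
        H_hyperplane a n i j H \<and> h_functional a n H h \<longrightarrow> complexify h \<beta> \<notin> \<int>)"

definition neg_ints :: "complex set" where
  "neg_ints = of_int ` {..<0}"

definition is_exponent ::
  "(nat \<Rightarrow> int ^ 'd) \<Rightarrow> nat \<Rightarrow> complex ^ 'd \<Rightarrow> nat \<Rightarrow> nat \<Rightarrow> (nat \<Rightarrow> complex) \<Rightarrow> bool" where
  "is_exponent a n \<beta> i b v \<longleftrightarrow>
     v \<in> coord_space n \<and> v i = of_nat b \<and> (\<Sum>\<mu>=1..n. v \<mu> *s of_int_vec (a \<mu>)) = \<beta>"

definition E_set ::
  "(nat \<Rightarrow> int ^ 'd) \<Rightarrow> nat \<Rightarrow> nat \<Rightarrow> (nat \<Rightarrow> nat) \<Rightarrow> complex ^ 'd \<Rightarrow> (nat \<Rightarrow> complex) set" where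
  "E_set a n k ell \<beta> = {v. \<exists>i\<in>{1..k}. \<exists>b\<in>{0..<ell i}. is_exponent a n \<beta> i b v}"

definition E'_set ::
  "(nat \<Rightarrow> int ^ 'd) \<Rightarrow> nat \<Rightarrow> nat \<Rightarrow> (nat \<Rightarrow> nat) \<Rightarrow> complex ^ 'd \<Rightarrow> (nat \<Rightarrow> complex) set" where
  "E'_set a n k ell \<beta> = {v \<in> E_set a n k ell \<beta>. \<forall>i\<in>{1..k}. v i \<notin> neg_ints}"

definition m_count :: "nat \<Rightarrow> (nat \<Rightarrow> complex) \<Rightarrow> nat" where
  "m_count k v = card {i \<in> {1..k}. v i \<in> \<nat>}"

definition nsupp :: "nat set \<Rightarrow> (nat \<Rightarrow> complex) \<Rightarrow> nat set" where
  "nsupp I w = {i \<in> I. w i \<in> neg_ints}"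

definition minimal_nsupp ::
  "(nat \<Rightarrow> int ^ 'd) \<Rightarrow> nat \<Rightarrow> nat set \<Rightarrow> int ^ 'd \<Rightarrow> (nat \<Rightarrow> complex) \<Rightarrow> bool" where
  "minimal_nsupp a n I u v \<longleftrightarrow>
     (\<forall>l\<in>int_sols a n u. \<not> nsupp I (\<lambda>\<mu>. v \<mu> + of_int (l \<mu>)) \<subset> nsupp I v)"

text \<open>
  \<open>M_coeff l c\<close> is \<open>M\<^bsub>l,0\<^esub>(c)\<close>; for \<open>l = 0\<close> both products are empty.  It is meaningless (a division
  by zero) if \<open>c\<close> is a negative integer and \<open>c + l \<ge> 0\<close>; the condition on negative supports in
  \<open>Phi_empty\<close> excludes this case.
\<close>

definition M_coeff :: "int \<Rightarrow> complex \<Rightarrow> complex" where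
  "M_coeff l c =
     (if l \<ge> 0 then 1 / (\<Prod>r=1..l. c + of_int r) else (\<Prod>r=l+1..0. c + of_int r))"

text \<open>
  A formal series of monomials \<open>x^w\<close> with complex exponent vectors \<open>w\<close> is represented by the
  function sending \<open>w\<close> to the coefficient of \<open>x^w\<close>.  The argument \<open>l\<close> is the chosen integer
  vector with \<open>(\<Sum>\<mu>=1..n. l \<mu> *s a \<mu>) = u\<close>.  The monomial \<open>x^(v + l) x\<^sub>0^z\<close> has exponent
  \<open>e z = v + l + z * signed_rel n k ell\<close>.  As the relation is nonzero, at most one \<open>z\<close>
  contributes to each coefficient.
\<close>

definition Phi_empty ::
  "nat \<Rightarrow> nat \<Rightarrow> (nat \<Rightarrow> nat) \<Rightarrow> (nat \<Rightarrow> complex) \<Rightarrow> (nat \<Rightarrow> int)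
     \<Rightarrow> (nat \<Rightarrow> complex) \<Rightarrow> complex" where
  "Phi_empty n k ell v l w =
     (let e = (\<lambda>z \<mu>. v \<mu> + of_int (l \<mu> + z * signed_rel n k ell \<mu>)) in
      \<Sum>z | nsupp {1..n} (e z) = nsupp {1..n} v \<and> e z = w.
        (\<Prod>i=1..k. M_coeff (l i + z * int (ell i)) (v i)) *
        (\<Prod>j=k+1..n. M_coeff (l j - z * int (ell j)) (v j)))"

end

theory Submission
  imports Defs
begin

text \<open>
  For \<open>i \<le> k < j\<close> let \<open>h\<close> be the linear form that vanishes on all \<open>a \<mu>\<close> with \<open>\<mu> \<noteq> i, j\<close> and
  satisfies \<open>h(ZA) = \<int>\<close>.  Writing \<open>\<beta> = \<Sum>v\<^sub>\<mu> a\<^sub>\<mu>\<close> gives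
  \<open>h(\<beta>) = v\<^sub>i h(a\<^sub>i) + v\<^sub>j h(a\<^sub>j)\<close>, where \<open>h(a\<^sub>i)\<close> and \<open>h(a\<^sub>j)\<close> are integers.  So if \<open>v\<^sub>i\<close> and
  \<open>v\<^sub>j\<close> were both integers, \<open>\<beta>\<close> would be resonant (\<open>nonresonant_coords_not_both_Ints\<close>).

  An exponent \<open>v\<close> in \<open>E'\<^sub>\<beta>\<close> has an integral coordinate \<open>v\<^sub>i = b\<close> with \<open>i \<le> k\<close>.  Hence no \<open>v\<^sub>j\<close>
  with \<open>j > k\<close> is an integer, while the coordinates with index at most \<open>k\<close> are not negative
  integers by definition of \<open>E'\<^sub>\<beta>\<close>.  So the negative support of \<open>v\<close> is empty.  The
  empty set has no proper subset, which gives minimality for every \<open>I\<close>.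

  For the series, take \<open>z\<close> so large that \<open>l\<^sub>i + z \<ell>\<^sub>i \<ge> 0\<close> for all \<open>i \<le> k\<close>.  Shifting by
  \<open>l + z \<ell>\<close> then creates no negative integer coordinate, so \<open>z\<close> occurs in the sum.
  A coefficient \<open>M\<^bsub>l,0\<^esub>(c)\<close> can vanish or have a pole only if \<open>c\<close> is an integer and the interval
  from \<open>c\<close> to \<open>c + l\<close> crosses from the nonnegative to the negative integers
  or back (\<open>M_coeff_nonzero\<close>); no factor of the \<open>z\<close>-th term does this, so that term is nonzero.
\<close>

section \<open>The primitive functional of a pair of points\<close>

lemma of_int_vec_sum:
  "of_int_vec (\<Sum>\<mu>\<in>S. l \<mu> *s a \<mu>) = (\<Sum>\<mu>\<in>S. of_int (l \<mu>) *\<^sub>R (of_int_vec (a \<mu>) :: real ^ 'd))"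
  by (simp add: of_int_vec_def vec_eq_iff)

lemma inj_of_int_vec: "inj (of_int_vec :: int ^ 'd \<Rightarrow> real ^ 'd)"
  by (rule injI) (simp add: of_int_vec_def vec_eq_iff)

lemma linear_of_int_vec_sum:
  fixes h :: "real ^ 'd \<Rightarrow> real"
  assumes "linear h"
  shows "h (of_int_vec (\<Sum>\<mu>\<in>S. l \<mu> *s a \<mu>)) = (\<Sum>\<mu>\<in>S. of_int (l \<mu>) * h (of_int_vec (a \<mu>)))"
  using assms by (simp add: of_int_vec_sum linear_sum linear_cmul)

lemma complexify_sum:
  fixes h :: "real ^ 'd \<Rightarrow> real"
  assumes "linear h"
  shows "complexify h (\<Sum>\<mu>\<in>S. v \<mu> *s of_int_vec (a \<mu>)) =
    (\<Sum>\<mu>\<in>S. v \<mu> * of_real (h (of_int_vec (a \<mu>))))"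
proof -
  have Re: "(\<chi> t. Re ((\<Sum>\<mu>\<in>S. v \<mu> *s of_int_vec (a \<mu>)) $ t)) =
      (\<Sum>\<mu>\<in>S. Re (v \<mu>) *\<^sub>R of_int_vec (a \<mu>))"
    by (simp add: vec_eq_iff of_int_vec_def)
  have Im: "(\<chi> t. Im ((\<Sum>\<mu>\<in>S. v \<mu> *s of_int_vec (a \<mu>)) $ t)) =
      (\<Sum>\<mu>\<in>S. Im (v \<mu>) *\<^sub>R of_int_vec (a \<mu>))"
    by (simp add: vec_eq_iff of_int_vec_def)
  show ?thesis
    unfolding complexify_def Re Im
    using assms by (simp add: complex_eq_iff linear_sum linear_cmul)
qed

text \<open>
  Prescribing \<open>h\<close> on the independent set \<open>A - {a\<^sub>j}\<close> leaves one value to be determined, and the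
  relation \<open>r\<close> forces \<open>r\<^sub>i h(a\<^sub>i) + r\<^sub>j h(a\<^sub>j) = 0\<close>.  So \<open>h(a\<^sub>i) = -r\<^sub>j/g\<close> and \<open>h(a\<^sub>j) = r\<^sub>i/g\<close> with
  \<open>g = gcd(r\<^sub>i, r\<^sub>j)\<close> are coprime integers, and Bezout's identity makes \<open>h(ZA)\<close> all of \<open>\<int>\<close>.
\<close>

lemma exists_primitive_functional:
  fixes a :: "nat \<Rightarrow> int ^ 'd" and r :: "nat \<Rightarrow> int"
  assumes inj: "inj_on a {1..n}"
    and dimV: "dim (real_V a n) = n - 1"
    and indep: "\<forall>B \<subseteq> real_pts a n. card B = n - 1 \<longrightarrow> independent B"
    and rel: "(\<Sum>\<mu>=1..n. r \<mu> *s a \<mu>) = 0"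
    and i: "i \<in> {1..n}" and j: "j \<in> {1..n}" and ij: "i \<noteq> j" and rj: "r j \<noteq> 0"
  obtains H h where "H_hyperplane a n i j H" "h_functional a n H h"
    "\<And>\<mu>. \<mu> \<in> {1..n} \<Longrightarrow> h (of_int_vec (a \<mu>)) \<in> \<int>"
    "\<And>\<mu>. \<mu> \<in> {1..n} - {i, j} \<Longrightarrow> h (of_int_vec (a \<mu>)) = 0"
proof -
  define A :: "nat \<Rightarrow> real ^ 'd" where "A \<mu> = of_int_vec (a \<mu>)" for \<mu>
  have pts: "real_pts a n = A ` {1..n}"
    by (simp add: real_pts_def A_def)
  have injA: "inj_on A {1..n}"
    unfolding A_def using comp_inj_on[OF inj inj_on_subset[OF inj_of_int_vec]]
    by (simp add: comp_def)
  have A_eq: "A \<mu> = A \<nu> \<longleftrightarrow> \<mu> = \<nu>" if "\<mu> \<in> {1..n}" "\<nu> \<in> {1..n}" for \<mu> \<nu>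
    using inj_on_eq_iff[OF injA that] .

  define B where "B = A ` ({1..n} - {j})"
  have "card B = n - 1"
    unfolding B_def using j by (simp add: card_image inj_on_subset[OF injA])
  moreover have "B \<subseteq> real_pts a n"
    by (auto simp: B_def pts)
  ultimately have indB: "independent B"
    using indep by blast

  define H where "H = span (A ` ({1..n} - {i, j}))"
  have "independent (A ` ({1..n} - {i, j}))"
    by (rule independent_mono[OF indB]) (auto simp: B_def)
  then have "dim H = card (A ` ({1..n} - {i, j}))"
    unfolding H_def by (rule dim_span_eq_card_independent)
  also have "\<dots> = n - 2"
    using i j ij by (simp add: card_image inj_on_subset[OF injA] card_Diff_subset)
  finally have dimH: "dim H = n - 2" .
  have "n \<ge> 2"
    using i j ij by auto
  have "real_pts a n - {of_int_vec (a i), of_int_vec (a j)} \<subseteq> A ` ({1..n} - {i, j})"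
    by (auto simp: pts A_def)
  then have HH: "H_hyperplane a n i j H"
    unfolding H_hyperplane_def dimV dimH using \<open>n \<ge> 2\<close>
    by (auto simp: H_def real_V_def pts intro: span_base subsetD[OF span_mono, rotated])

  define g where "g = gcd (r i) (r j)"
  have g0: "g \<noteq> 0"
    using rj by (simp add: g_def)
  define p q where "p = - (r j div g)" and "q = r i div g"
  have gp: "r j = - p * g" and gq: "r i = q * g"
    by (simp_all add: p_def q_def g_def)

  obtain h where lin: "linear h" and h_B: "\<forall>x\<in>B. h x = (if x = A i then real_of_int p else 0)"
    using linear_independent_extend[OF indB, of "\<lambda>x. if x = A i then real_of_int p else 0"] by blast
  have hi: "h (A i) = p"
    using h_B i ij by (auto simp: B_def)
  have h0: "h (A \<mu>) = 0" if "\<mu> \<in> {1..n} - {i, j}" for \<mu>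
    using h_B that i by (auto simp: B_def A_eq)
  have h_sum: "h (of_int_vec (\<Sum>\<mu>=1..n. l \<mu> *s a \<mu>)) = l i * h (A i) + l j * h (A j)"
    for l :: "nat \<Rightarrow> int"
  proof -
    have "h (of_int_vec (\<Sum>\<mu>=1..n. l \<mu> *s a \<mu>)) = (\<Sum>\<mu>\<in>{1..n}. l \<mu> * h (A \<mu>))"
      by (simp add: linear_of_int_vec_sum[OF lin] A_def)
    also have "\<dots> = (\<Sum>\<mu>\<in>{i, j}. l \<mu> * h (A \<mu>))"
      by (rule sum.mono_neutral_right) (use i j h0 in auto)
    finally show ?thesis
      using ij by simp
  qed
  have hj: "h (A j) = q"
  proof -
    have "r i * h (A i) + r j * h (A j) = 0"
      using h_sum[of r] linear_0[OF lin] unfolding rel by (simp add: of_int_vec_def zero_vec_def)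
    then have "real_of_int p * g * (h (A j) - q) = 0"
      unfolding hi gp gq by (auto simp: algebra_simps)
    moreover have "p \<noteq> 0"
      using rj gp by auto
    ultimately show ?thesis
      using g0 by simp
  qed

  have "h ` of_int_vec ` ZA a n = \<int>"
  proof (intro equalityI subsetI)
    fix y assume "y \<in> h ` of_int_vec ` ZA a n"
    then obtain l where "y = h (of_int_vec (\<Sum>\<mu>=1..n. l \<mu> *s a \<mu>))"
      by (auto simp: ZA_def)
    then show "y \<in> \<int>"
      by (simp only: h_sum hi hj) simp
  next
    fix y :: real assume "y \<in> \<int>"
    then obtain m :: int where m: "y = m"
      by (auto elim: Ints_cases)
    obtain s t where "s * r i + t * r j = g"
      using bezout_int[of "r i" "r j"] by (auto simp: g_def)
    then have "(s * q - t * p) * g = 1 * g"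
      by (subst (asm) gp, subst (asm) gq) (simp add: algebra_simps)
    then have "s * q - t * p = 1"
      using g0 by (metis mult_right_cancel)
    then have "(- t * m) * p + (s * m) * q = m"
      by algebra
    then have "real_of_int (- t * m) * p + real_of_int (s * m) * q = m"
      by (metis of_int_add of_int_mult)
    then have "y = h (of_int_vec (\<Sum>\<mu>=1..n. (if \<mu> = i then - t * m else s * m) *s a \<mu>))"
      (is "y = h (of_int_vec ?x)")
      using ij by (simp only: h_sum hi hj m) simp
    moreover have "?x \<in> ZA a n"
      unfolding ZA_def
      by (intro CollectI exI[of _ "\<lambda>\<mu>. if \<mu> = i then - t * m else s * m"]) simp
    ultimately show "y \<in> h ` of_int_vec ` ZA a n"
      by (simp only: imageI)
  qed
  moreover have "h x = 0" if "x \<in> H" for x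
    using linear_eq_0_on_span[OF lin _ that[unfolded H_def]] h0 by blast
  ultimately have "h_functional a n H h"
    by (simp add: h_functional_def lin)
  moreover have "h (A \<mu>) \<in> \<int>" if "\<mu> \<in> {1..n}" for \<mu>
    using that h0[of \<mu>] hi hj by (cases "\<mu> \<in> {i, j}") auto
  ultimately show ?thesis
    using that HH h0 unfolding A_def by blast
qed

lemma nonresonant_coords_not_both_Ints:
  fixes a :: "nat \<Rightarrow> int ^ 'd" and r :: "nat \<Rightarrow> int"
  assumes "inj_on a {1..n}"
    and "dim (real_V a n) = n - 1"
    and "\<forall>B \<subseteq> real_pts a n. card B = n - 1 \<longrightarrow> independent B"
    and "(\<Sum>\<mu>=1..n. r \<mu> *s a \<mu>) = 0"
    and kn: "k \<le> n" and nonres: "nonresonant a n k \<beta>"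
    and \<beta>: "(\<Sum>\<mu>=1..n. v \<mu> *s of_int_vec (a \<mu>)) = \<beta>"
    and i: "i \<in> {1..k}" and j: "j \<in> {k+1..n}" and "r j \<noteq> 0"
    and vi: "v i \<in> \<int>"
  shows "v j \<notin> \<int>"
proof
  assume vj: "v j \<in> \<int>"
  have "i \<in> {1..n}" "j \<in> {1..n}" "i \<noteq> j"
    using i j kn by auto
  then obtain H h where H: "H_hyperplane a n i j H" and h: "h_functional a n H h"
    and hZ: "\<And>\<mu>. \<mu> \<in> {1..n} \<Longrightarrow> h (of_int_vec (a \<mu>)) \<in> \<int>"
    and h0: "\<And>\<mu>. \<mu> \<in> {1..n} - {i, j} \<Longrightarrow> h (of_int_vec (a \<mu>)) = 0"
    using exists_primitive_functional[OF assms(1-4) _ _ _ \<open>r j \<noteq> 0\<close>] by metis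
  have "linear h"
    using h by (simp add: h_functional_def)
  then have "complexify h \<beta> = (\<Sum>\<mu>=1..n. v \<mu> * of_real (h (of_int_vec (a \<mu>))))"
    using \<beta> complexify_sum by blast
  also have "\<dots> \<in> \<int>"
  proof (rule Ints_sum)
    fix \<mu> assume \<mu>: "\<mu> \<in> {1..n}"
    have "complex_of_real (h (of_int_vec (a \<mu>))) \<in> \<int>"
      using hZ[OF \<mu>] by (auto elim!: Ints_cases)
    then show "v \<mu> * of_real (h (of_int_vec (a \<mu>))) \<in> \<int>"
      using vi vj h0[of \<mu>] \<mu> by (cases "\<mu> \<in> {i, j}") (auto intro: Ints_mult)
  qed
  finally show False
    using nonres i j H h by (auto simp: nonresonant_def)
qed

section \<open>Negative supports and nonzero terms\<close>

lemma neg_ints_subset_Ints: "neg_ints \<subseteq> \<int>"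
  by (auto simp: neg_ints_def)

lemma add_of_int_in_neg_ints_imp_Ints:
  assumes "c + of_int m \<in> neg_ints"
  shows "c \<in> \<int>"
proof -
  have "c + of_int m - of_int m \<in> \<int>"
    using assms neg_ints_subset_Ints by (blast intro: Ints_diff Ints_of_int)
  then show ?thesis
    by simp
qed

lemma add_of_int_notin_neg_ints:
  assumes "c \<notin> neg_ints" "m \<ge> 0"
  shows "c + of_int m \<notin> neg_ints"
proof
  assume "c + of_int m \<in> neg_ints"
  then obtain x :: int where "x < 0" "c + of_int m = of_int x"
    by (auto simp: neg_ints_def)
  then have "c = of_int (x - m)" "x - m < 0"
    using \<open>m \<ge> 0\<close> by (simp_all add: algebra_simps)
  then show False
    using assms(1) unfolding neg_ints_def by blast
qed

text \<open>
  The factors \<open>c + r\<close> of the denominator (for \<open>l \<ge> 0\<close>) have \<open>r > 0\<close> and vanish only at negative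
  integers \<open>c\<close>; those of the numerator (for \<open>l < 0\<close>) vanish only at integers.
\<close>

lemma M_coeff_nonzero:
  assumes "c \<notin> neg_ints" and "l \<ge> 0 \<or> c \<notin> \<int>"
  shows "M_coeff l c \<noteq> 0"
proof -
  have "c + of_int r \<noteq> 0" if "r > 0 \<or> c \<notin> \<int>" for r
  proof
    assume "c + of_int r = 0"
    then have "c = of_int (- r)"
      by (simp add: add_eq_0_iff2)
    moreover from this have "r \<le> 0"
      using assms(1) unfolding neg_ints_def by (metis imageI lessThan_iff neg_less_0_iff_less not_less)
    ultimately show False
      using that by auto
  qed
  then show ?thesis
    using assms(2) by (auto simp: M_coeff_def)
qed

lemma exists_int_multiple_ge:
  fixes f l :: "'a \<Rightarrow> int"
  assumes "finite S" and "\<And>i. i \<in> S \<Longrightarrow> f i > 0"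
  obtains z where "\<And>i. i \<in> S \<Longrightarrow> l i + z * f i \<ge> 0"
proof
  fix i assume i: "i \<in> S"
  let ?z = "\<Sum>i\<in>S. \<bar>l i\<bar>"
  have "\<bar>l i\<bar> \<le> ?z"
    using assms(1) i by (intro member_le_sum) auto
  also have "?z \<le> ?z * f i"
    using mult_left_mono[of 1 "f i" ?z] assms(2)[OF i] by (simp add: sum_nonneg)
  finally show "l i + ?z * f i \<ge> 0"
    by linarith
qed

text \<open>
  Distinct \<open>z\<close> give distinct monomials because \<open>\<ell>\<close> is nonzero, so the coefficient of the
  monomial belonging to \<open>z\<close> is a single product.
\<close>

lemma Phi_empty_coeff:
  assumes "signed_rel n k ell \<mu> \<noteq> 0"
    and e: "e = (\<lambda>z \<nu>. v \<nu> + of_int (l \<nu> + z * signed_rel n k ell \<nu>))"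
    and supp: "nsupp {1..n} (e z) = nsupp {1..n} v"
  shows "Phi_empty n k ell v l (e z) =
    (\<Prod>i=1..k. M_coeff (l i + z * int (ell i)) (v i)) *
    (\<Prod>j=k+1..n. M_coeff (l j - z * int (ell j)) (v j))"
proof -
  have "y = z" if "e y = e z" for y
  proof -
    have "(of_int (l \<mu> + y * signed_rel n k ell \<mu>) :: complex)
        = of_int (l \<mu> + z * signed_rel n k ell \<mu>)"
      using fun_cong[OF that, of \<mu>] unfolding e by (simp only: add_left_cancel)
    then show ?thesis
      using assms(1) by (simp only: of_int_eq_iff) simp
  qed
  then have "{y. nsupp {1..n} (e y) = nsupp {1..n} v \<and> e y = e z} = {z}"
    using supp by auto
  then show ?thesis
    unfolding Phi_empty_def Let_def e[symmetric] by simp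
qed

lemma Phi_empty_nonzero:
  assumes k: "1 \<le> k" and ell: "\<And>i. i \<in> {1..k} \<Longrightarrow> ell i > 0"
    and v_low: "\<And>i. i \<in> {1..k} \<Longrightarrow> v i \<notin> neg_ints"
    and v_high: "\<And>j. j \<in> {k+1..n} \<Longrightarrow> v j \<notin> \<int>"
  shows "Phi_empty n k ell v l \<noteq> (\<lambda>w. 0)"
proof -
  obtain z where z: "\<And>i. i \<in> {1..k} \<Longrightarrow> l i + z * int (ell i) \<ge> 0"
    using exists_int_multiple_ge[of "{1..k}" "\<lambda>i. int (ell i)" l] ell
    by (metis finite_atLeastAtMost of_nat_0_less_iff)
  define e where "e = (\<lambda>z \<nu>. v \<nu> + of_int (l \<nu> + z * signed_rel n k ell \<nu>))"
  have v_neg: "v \<nu> \<notin> neg_ints" if "\<nu> \<in> {1..n}" for \<nu>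
    using that v_low[of \<nu>] v_high[of \<nu>] neg_ints_subset_Ints by (cases "\<nu> \<le> k") auto
  have e_neg: "e z \<nu> \<notin> neg_ints" if "\<nu> \<in> {1..n}" for \<nu>
  proof (cases "\<nu> \<le> k")
    case True
    then show ?thesis
      unfolding e_def using that z[of \<nu>] v_low[of \<nu>]
      by (intro add_of_int_notin_neg_ints) (auto simp: signed_rel_def)
  next
    case False
    then show ?thesis
      unfolding e_def using that v_high[of \<nu>] add_of_int_in_neg_ints_imp_Ints
      by (metis Suc_eq_plus1 atLeastAtMost_iff not_less_eq_eq)
  qed
  have "nsupp {1..n} (e z) = nsupp {1..n} v"
    using v_neg e_neg by (auto simp: nsupp_def)
  moreover have "signed_rel n k ell 1 \<noteq> 0"
    using k ell[of 1] by (simp add: signed_rel_def)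
  ultimately have "Phi_empty n k ell v l (e z) =
    (\<Prod>i=1..k. M_coeff (l i + z * int (ell i)) (v i)) *
    (\<Prod>j=k+1..n. M_coeff (l j - z * int (ell j)) (v j))"
    using Phi_empty_coeff e_def by blast
  moreover have "M_coeff (l i + z * int (ell i)) (v i) \<noteq> 0" if "i \<in> {1..k}" for i
    using that z v_low by (intro M_coeff_nonzero) auto
  moreover have "M_coeff (l j - z * int (ell j)) (v j) \<noteq> 0" if "j \<in> {k+1..n}" for j
    using that v_high v_neg[of j] by (intro M_coeff_nonzero) auto
  ultimately have "Phi_empty n k ell v l (e z) \<noteq> 0"
    by simp
  then show ?thesis
    by auto
qed

section \<open>Exponents of a nonresonant parameter\<close>

theorem theorem7p2:
  fixes a :: "nat \<Rightarrow> int ^ 'd" and n k :: nat and ell :: "nat \<Rightarrow> nat" and \<beta> :: "complex ^ 'd"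
  assumes "1 \<le> k" and "k \<le> n"
    and "inj_on a {1..n}"
    and "dim (real_V a n) = n - 1"
    and "\<forall>B \<subseteq> real_pts a n. card B = n - 1 \<longrightarrow> independent B"
    and "\<forall>\<mu>\<in>{1..n}. ell \<mu> > 0"
    and "Gcd (ell ` {1..n}) = 1"
    and "int_sols a n 0 = {\<lambda>\<mu>. c * signed_rel n k ell \<mu> | c. True}"
    and "\<beta> \<in> complex_V a n"
    and "nonresonant a n k \<beta>"
  shows "\<forall>v \<in> E'_set a n k ell \<beta>. \<forall>u \<in> ZA a n.
      (\<forall>I \<subseteq> {1..n}. int (card I) \<ge> int n - (int (m_count k v) - 1) \<longrightarrow> minimal_nsupp a n I u v)
      \<and> (\<forall>l \<in> int_sols a n u. Phi_empty n k ell v l \<noteq> (\<lambda>w. 0))"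
proof (intro ballI conjI allI impI)
  fix v u assume v: "v \<in> E'_set a n k ell \<beta>"
  then obtain i b where i: "i \<in> {1..k}" and "is_exponent a n \<beta> i b v"
    by (auto simp: E'_set_def E_set_def)
  then have vi: "v i \<in> \<int>" and \<beta>: "(\<Sum>\<mu>=1..n. v \<mu> *s of_int_vec (a \<mu>)) = \<beta>"
    by (auto simp: is_exponent_def)
  have "signed_rel n k ell \<in> int_sols a n 0"
    unfolding assms(8) by (rule CollectI, rule exI[of _ 1]) simp
  then have rel: "(\<Sum>\<mu>=1..n. signed_rel n k ell \<mu> *s a \<mu>) = 0"
    by (simp add: int_sols_def)
  have v_low: "v \<mu> \<notin> neg_ints" if "\<mu> \<in> {1..k}" for \<mu>
    using v that by (simp add: E'_set_def)
  have v_high: "v j \<notin> \<int>" if j: "j \<in> {k+1..n}" for j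
  proof (rule nonresonant_coords_not_both_Ints[OF assms(3-5) rel assms(2,10) \<beta> i j _ vi])
    have "ell j > 0"
      using assms(6) j by simp
    then show "signed_rel n k ell j \<noteq> 0"
      using j by (simp add: signed_rel_def)
  qed
  show "minimal_nsupp a n I u v" if "I \<subseteq> {1..n}" for I
  proof -
    have "v \<mu> \<notin> neg_ints" if "\<mu> \<in> {1..n}" for \<mu>
      using that v_low[of \<mu>] v_high[of \<mu>] neg_ints_subset_Ints by (cases "\<mu> \<le> k") auto
    then have "nsupp I v = {}"
      using that by (auto simp: nsupp_def)
    then show ?thesis
      by (simp add: minimal_nsupp_def)
  qed
  show "Phi_empty n k ell v l \<noteq> (\<lambda>w. 0)" for l
    using assms(1,2,6) v_low v_high by (intro Phi_empty_nonzero) auto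
qed

end
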